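(* (i) An upper symmetric skew lattice is $\wedge$-distributive if and only if it is both quasi-distributive and linearly distributive. (ii) A lower symmetric skew lattice is $\vee$-distributive if and only if it is both quasi-distributive and linearly distributive. (iii) Thus a symmetric skew lattice is distributive if and only if it is both quasi-distributive and linearly distributive.
   Context: A skew lattice is a set $S$ with two associative, idempotent binary operations $\wedge,\vee$ satisfying $x\wedge (x\vee y) = x = (y\vee x)\wedge x$ and $x\vee (x\wedge y) = x = (y\wedge x)\vee x$. It is $\wedge$-distributive if it satisfies $x\wedge (y\vee z)\wedge x = (x\wedge y\wedge x)\vee (x\wedge z\wedge x)$, $\vee$-distributive if it satisfies $x\vee (y\wedge z)\vee x = (x\vee y\vee x)\wedge (x\vee z\vee x)$, and distributive if it satisfies both. It is upper symmetric if $x\wedge y=y\wedge x$ implies $x\vee y=y\vee x$ for all $x,y$; lower symmetric if $x\vee y=y\vee x$ implies $x\wedge y=y\wedge x$ for all $x,y$; symmetric if it is both. The natural preorder is $a\succeq b$ iff $a\vee b\vee a=a$ (equivalently $b\wedge a\wedge b=b$). The relation $a\mathrel{\mathcal D}b$ iff $a\succeq b$ and $b\succeq a$ is a congruence, and $S/\mathcal D$ is the maximal lattice image of $S$. $S$ is quasi-distributive if $S/\mathcal D$ is a distributive lattice. $S$ is linearly distributive if every subalgebra $T$ of $S$ that is totally preordered (for all $a,b\in T$, $a\succeq b$ or $b\succeq a$) is distributive. *)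

theory Defs
  imports Main
begin

(* Algebras are given by an explicit carrier set, so that subalgebras of S and the quotient
   of S by a congruence can be treated by the same predicates as S itself. *)

locale skew_lattice =
  fixes S :: "'a set"
    and meet :: "'a \<Rightarrow> 'a \<Rightarrow> 'a" (infixl "\<sqinter>" 70)
    and join :: "'a \<Rightarrow> 'a \<Rightarrow> 'a" (infixl "\<squnion>" 65)
  assumes meet_closed: "\<lbrakk>x \<in> S; y \<in> S\<rbrakk> \<Longrightarrow> x \<sqinter> y \<in> S"
    and join_closed: "\<lbrakk>x \<in> S; y \<in> S\<rbrakk> \<Longrightarrow> x \<squnion> y \<in> S"
    and meet_assoc: "\<lbrakk>x \<in> S; y \<in> S; z \<in> S\<rbrakk> \<Longrightarrow> (x \<sqinter> y) \<sqinter> z = x \<sqinter> (y \<sqinter> z)"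
    and join_assoc: "\<lbrakk>x \<in> S; y \<in> S; z \<in> S\<rbrakk> \<Longrightarrow> (x \<squnion> y) \<squnion> z = x \<squnion> (y \<squnion> z)"
    and meet_idem: "x \<in> S \<Longrightarrow> x \<sqinter> x = x"
    and join_idem: "x \<in> S \<Longrightarrow> x \<squnion> x = x"
    and meet_join_absorb_left: "\<lbrakk>x \<in> S; y \<in> S\<rbrakk> \<Longrightarrow> x \<sqinter> (x \<squnion> y) = x"
    and meet_join_absorb_right: "\<lbrakk>x \<in> S; y \<in> S\<rbrakk> \<Longrightarrow> (y \<squnion> x) \<sqinter> x = x"
    and join_meet_absorb_left: "\<lbrakk>x \<in> S; y \<in> S\<rbrakk> \<Longrightarrow> x \<squnion> (x \<sqinter> y) = x"
    and join_meet_absorb_right: "\<lbrakk>x \<in> S; y \<in> S\<rbrakk> \<Longrightarrow> (y \<sqinter> x) \<squnion> x = x"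

locale distributive_lattice_on =
  fixes L :: "'a set"
    and meet :: "'a \<Rightarrow> 'a \<Rightarrow> 'a" (infixl "\<sqinter>" 70)
    and join :: "'a \<Rightarrow> 'a \<Rightarrow> 'a" (infixl "\<squnion>" 65)
  assumes meet_closed: "\<lbrakk>x \<in> L; y \<in> L\<rbrakk> \<Longrightarrow> x \<sqinter> y \<in> L"
    and join_closed: "\<lbrakk>x \<in> L; y \<in> L\<rbrakk> \<Longrightarrow> x \<squnion> y \<in> L"
    and meet_assoc: "\<lbrakk>x \<in> L; y \<in> L; z \<in> L\<rbrakk> \<Longrightarrow> (x \<sqinter> y) \<sqinter> z = x \<sqinter> (y \<sqinter> z)"
    and join_assoc: "\<lbrakk>x \<in> L; y \<in> L; z \<in> L\<rbrakk> \<Longrightarrow> (x \<squnion> y) \<squnion> z = x \<squnion> (y \<squnion> z)"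
    and meet_commute: "\<lbrakk>x \<in> L; y \<in> L\<rbrakk> \<Longrightarrow> x \<sqinter> y = y \<sqinter> x"
    and join_commute: "\<lbrakk>x \<in> L; y \<in> L\<rbrakk> \<Longrightarrow> x \<squnion> y = y \<squnion> x"
    and meet_join_absorb: "\<lbrakk>x \<in> L; y \<in> L\<rbrakk> \<Longrightarrow> x \<sqinter> (x \<squnion> y) = x"
    and join_meet_absorb: "\<lbrakk>x \<in> L; y \<in> L\<rbrakk> \<Longrightarrow> x \<squnion> (x \<sqinter> y) = x"
    and meet_join_distrib:
      "\<lbrakk>x \<in> L; y \<in> L; z \<in> L\<rbrakk> \<Longrightarrow> x \<sqinter> (y \<squnion> z) = (x \<sqinter> y) \<squnion> (x \<sqinter> z)"

context
  fixes S :: "'a set"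
    and meet :: "'a \<Rightarrow> 'a \<Rightarrow> 'a" (infixl "\<sqinter>" 70)
    and join :: "'a \<Rightarrow> 'a \<Rightarrow> 'a" (infixl "\<squnion>" 65)
begin

definition meet_distributive :: bool where
  "meet_distributive \<longleftrightarrow>
    (\<forall>x\<in>S. \<forall>y\<in>S. \<forall>z\<in>S. x \<sqinter> (y \<squnion> z) \<sqinter> x = (x \<sqinter> y \<sqinter> x) \<squnion> (x \<sqinter> z \<sqinter> x))"

definition join_distributive :: bool where
  "join_distributive \<longleftrightarrow>
    (\<forall>x\<in>S. \<forall>y\<in>S. \<forall>z\<in>S. x \<squnion> (y \<sqinter> z) \<squnion> x = (x \<squnion> y \<squnion> x) \<sqinter> (x \<squnion> z \<squnion> x))"

definition skew_distributive :: bool where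
  "skew_distributive \<longleftrightarrow> meet_distributive \<and> join_distributive"

definition upper_symmetric :: bool where
  "upper_symmetric \<longleftrightarrow> (\<forall>x\<in>S. \<forall>y\<in>S. x \<sqinter> y = y \<sqinter> x \<longrightarrow> x \<squnion> y = y \<squnion> x)"

definition lower_symmetric :: bool where
  "lower_symmetric \<longleftrightarrow> (\<forall>x\<in>S. \<forall>y\<in>S. x \<squnion> y = y \<squnion> x \<longrightarrow> x \<sqinter> y = y \<sqinter> x)"

definition skew_symmetric :: bool where
  "skew_symmetric \<longleftrightarrow> upper_symmetric \<and> lower_symmetric"

definition natural_ge :: "'a \<Rightarrow> 'a \<Rightarrow> bool" where
  "natural_ge a b \<longleftrightarrow> a \<squnion> b \<squnion> a = a"

definition D_rel :: "('a \<times> 'a) set" where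
  "D_rel = {(a, b). a \<in> S \<and> b \<in> S \<and> natural_ge a b \<and> natural_ge b a}"

definition subalgebra :: "'a set \<Rightarrow> bool" where
  "subalgebra T \<longleftrightarrow> T \<subseteq> S \<and> (\<forall>x\<in>T. \<forall>y\<in>T. x \<sqinter> y \<in> T \<and> x \<squnion> y \<in> T)"

end

(* The operation induced by f on classes of R. If R is a congruence for f, all the classes in
   the union coincide, so the value is the class of f a b for any a in A and b in B. *)
definition quotient_op ::
  "('a \<times> 'a) set \<Rightarrow> ('a \<Rightarrow> 'a \<Rightarrow> 'a) \<Rightarrow> 'a set \<Rightarrow> 'a set \<Rightarrow> 'a set" where
  "quotient_op R f A B = (\<Union>a\<in>A. \<Union>b\<in>B. R `` {f a b})"

definition quasi_distributive ::
  "'a set \<Rightarrow> ('a \<Rightarrow> 'a \<Rightarrow> 'a) \<Rightarrow> ('a \<Rightarrow> 'a \<Rightarrow> 'a) \<Rightarrow> bool" where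
  "quasi_distributive S meet join \<longleftrightarrow>
    distributive_lattice_on (S // D_rel S join)
      (quotient_op (D_rel S join) meet) (quotient_op (D_rel S join) join)"

definition linearly_distributive ::
  "'a set \<Rightarrow> ('a \<Rightarrow> 'a \<Rightarrow> 'a) \<Rightarrow> ('a \<Rightarrow> 'a \<Rightarrow> 'a) \<Rightarrow> bool" where
  "linearly_distributive S meet join \<longleftrightarrow>
    (\<forall>T. subalgebra S meet join T \<and>
         (\<forall>a\<in>T. \<forall>b\<in>T. natural_ge join a b \<or> natural_ge join b a) \<longrightarrow>
       skew_distributive T meet join)"

end

theory Submission
  imports Defs
begin

text \<open>
  Write \<open>\<preceq>\<close> for the natural preorder, in which \<open>a \<preceq> b\<close> means \<open>a \<sqinter> b \<sqinter> a = a\<close>, or equivalently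
  \<open>b \<squnion> a \<squnion> b = b\<close>, and \<open>\<le>\<^sub>S\<close> for the natural partial order, which refines it. An element below another
  in the partial order and equivalent to it in the preorder is equal to it. Most equations
  below are obtained in this way: the preorder part is a computation in the lattice of
  \<open>\<D>\<close>-classes, and the partial order part comes from the fact that the sandwich maps
  \<open>a \<mapsto> x \<sqinter> a \<sqinter> x\<close> and \<open>a \<mapsto> x \<squnion> a \<squnion> x\<close> are monotone (\<open>sandwich_mono\<close>). Monotonicity rests on
  the regularity of the two band reducts (\<open>meet_regular\<close>).

  Since \<open>y \<squnion> z = (z \<squnion> y \<squnion> z) \<sqinter> (y \<squnion> z \<squnion> y)\<close> and sandwich maps preserve meets, \<open>\<sqinter>\<close>-distributivity
  amounts to
  \<open>x \<sqinter> (y \<squnion> z \<squnion> y) \<sqinter> x = (x \<sqinter> y \<sqinter> x) \<squnion> (x \<sqinter> z \<sqinter> x) \<squnion> (x \<sqinter> y \<sqinter> x)\<close>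
  (\<open>meet_distributive_if_sandwich\<close>). The advantage of
  this sandwiched law is that \<open>y \<squnion> z \<squnion> y\<close>, unlike \<open>y \<squnion> z\<close>, lies above \<open>y\<close> in the partial order.

  A \<open>\<sqinter>\<close>-distributive skew lattice is quasi-distributive, because the law passes to the lattice of
  \<open>\<D>\<close>-classes. It is linearly distributive because, on a totally preordered skew lattice,
  \<open>\<sqinter>\<close>-distributivity forces \<open>\<squnion>\<close>-distributivity (\<open>join_distributive_if_total\<close>).

  Conversely, assume upper symmetry, quasi-distributivity and linear distributivity. The last
  provides both distributive laws for elements that lie in a chain of \<open>\<D>\<close>-classes. If \<open>m\<close> is a common
  lower bound of \<open>x\<close> and \<open>z\<close>, then \<open>z, x \<sqinter> z, m\<close> and \<open>x, x \<sqinter> z, m\<close> represent such chains, and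
  passing through the middle class gives the sandwiched law for \<open>x, m, z\<close>
  (\<open>sandwich_distrib_lower_bound\<close>). If \<open>m \<preceq> z\<close> only, quasi-distributivity makes it possible to shrink
  \<open>z\<close> to the class of \<open>(x \<sqinter> z) \<squnion> m\<close>, and there upper symmetry writes the join as a commuting join of
  \<open>m\<close> with an element of the class of \<open>x \<sqinter> z\<close> (\<open>sandwich_distrib_modular\<close>,
  \<open>sandwich_distrib_comparable\<close>). For arbitrary \<open>y\<close> and \<open>z\<close>, put \<open>m = y \<sqinter> z \<sqinter> y\<close>. The element
  \<open>m \<squnion> z \<squnion> m\<close> commutes with \<open>y\<close> under the meet, hence under the join, and their join is
  \<open>y \<squnion> z \<squnion> y\<close>. Sandwich maps distribute over commuting joins by monotonicity and
  quasi-distributivity, which leaves the comparable pair \<open>m, z\<close> (\<open>sandwich_distrib\<close>).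

  The second part is the first one applied to the skew lattice with the two operations exchanged;
  exchanging them preserves quasi-distributivity and linear distributivity. The third part
  combines the other two.
\<close>

section \<open>Bands and their natural preorder\<close>

locale band_on =
  fixes S :: "'a set" and mult :: "'a \<Rightarrow> 'a \<Rightarrow> 'a" (infixl "\<cdot>" 70)
  assumes closed [simp, intro]: "\<lbrakk>x \<in> S; y \<in> S\<rbrakk> \<Longrightarrow> x \<cdot> y \<in> S"
    and assoc: "\<lbrakk>x \<in> S; y \<in> S; z \<in> S\<rbrakk> \<Longrightarrow> (x \<cdot> y) \<cdot> z = x \<cdot> (y \<cdot> z)"
    and idem [simp]: "x \<in> S \<Longrightarrow> x \<cdot> x = x"
begin

lemma left_idem [simp]: "\<lbrakk>x \<in> S; y \<in> S\<rbrakk> \<Longrightarrow> x \<cdot> (x \<cdot> y) = x \<cdot> y"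
  by (simp flip: assoc)

lemma idem2 [simp]: "\<lbrakk>x \<in> S; y \<in> S\<rbrakk> \<Longrightarrow> x \<cdot> (y \<cdot> (x \<cdot> y)) = x \<cdot> y"
  using idem[of "x \<cdot> y"] by (simp add: assoc del: idem)

lemma left_idem2 [simp]:
  "\<lbrakk>x \<in> S; y \<in> S; z \<in> S\<rbrakk> \<Longrightarrow> x \<cdot> (y \<cdot> (x \<cdot> (y \<cdot> z))) = x \<cdot> (y \<cdot> z)"
  using left_idem[of "x \<cdot> y" z] by (simp add: assoc del: left_idem)

lemma absorb_of_factor_left:
  "\<lbrakk>a \<in> S; q \<in> S\<rbrakk> \<Longrightarrow> (a \<cdot> q) \<cdot> a \<cdot> (a \<cdot> q) = a \<cdot> q"
  by (simp add: assoc)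

lemma absorb_of_factor_right:
  "\<lbrakk>a \<in> S; p \<in> S\<rbrakk> \<Longrightarrow> (p \<cdot> a) \<cdot> a \<cdot> (p \<cdot> a) = p \<cdot> a"
  by (simp add: assoc)

text \<open>
  The one-sided cases are immediate. Applied to the factor \<open>p \<cdot> a\<close>, the left one puts \<open>a \<cdot> c\<close> at the
  right end of a factorisation of \<open>c\<close>, so that the right one finishes.
\<close>

lemma absorb_of_factor:
  assumes S: "a \<in> S" "p \<in> S" "q \<in> S" and c: "c = p \<cdot> a \<cdot> q"
  shows "c \<cdot> a \<cdot> c = c"
proof -
  have cS: "c \<in> S" using S c by simp
  have "c \<cdot> (p \<cdot> a) \<cdot> c = c"
    using absorb_of_factor_left[of "p \<cdot> a" q] S c by simp
  then have c': "c = (c \<cdot> p) \<cdot> (a \<cdot> c)"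
    using S cS by (simp add: assoc)
  have "c \<cdot> (a \<cdot> c) \<cdot> c = c"
    using absorb_of_factor_right[of "a \<cdot> c" "c \<cdot> p"] S cS unfolding c'[symmetric] by simp
  then show ?thesis using S cS by (simp add: assoc)
qed

definition prec :: "'a \<Rightarrow> 'a \<Rightarrow> bool" where
  "prec a b \<longleftrightarrow> a \<in> S \<and> b \<in> S \<and> a \<cdot> b \<cdot> a = a"

text \<open>
  The preorder is division in the band, which is why it is transitive.
\<close>

lemma prec_factor:
  "\<lbrakk>a \<in> S; p \<in> S; q \<in> S\<rbrakk> \<Longrightarrow> prec (p \<cdot> a \<cdot> q) a"
  unfolding prec_def using absorb_of_factor by blast

lemma prec_refl: "a \<in> S \<Longrightarrow> prec a a"
  by (simp add: prec_def)

lemma prec_mult_left: "\<lbrakk>a \<in> S; b \<in> S\<rbrakk> \<Longrightarrow> prec (a \<cdot> b) a"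
  by (simp add: prec_def absorb_of_factor_left)

lemma prec_mult_right: "\<lbrakk>a \<in> S; b \<in> S\<rbrakk> \<Longrightarrow> prec (a \<cdot> b) b"
  by (simp add: prec_def absorb_of_factor_right)

lemma prec_trans:
  assumes "prec a b" "prec b c"
  shows "prec a c"
proof -
  have S: "a \<in> S" "b \<in> S" "c \<in> S" and eq: "a \<cdot> b \<cdot> a = a" "b \<cdot> c \<cdot> b = b"
    using assms by (auto simp: prec_def)
  have "a = (a \<cdot> b) \<cdot> c \<cdot> (b \<cdot> a)"
    using S eq by (metis assoc closed)
  then show ?thesis using prec_factor[of c "a \<cdot> b" "b \<cdot> a"] S by simp
qed

lemma prec_mult_swap: "\<lbrakk>a \<in> S; b \<in> S\<rbrakk> \<Longrightarrow> prec (a \<cdot> b) (b \<cdot> a)"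
  by (simp add: prec_def assoc)

text \<open>
  Together with \<open>prec_mult_left\<close> and \<open>prec_mult_right\<close> this makes the product a greatest lower bound in
  the preorder. A common lower bound \<open>x\<close> is absorbed by \<open>a \<cdot> x \<cdot> b\<close>, and a product can be rotated
  without leaving its equivalence class, so \<open>x\<close> can be removed from the middle.
\<close>

lemma prec_mult:
  assumes "prec x a" "prec x b"
  shows "prec x (a \<cdot> b)"
proof -
  have S: "a \<in> S" "b \<in> S" "x \<in> S" and eq: "x \<cdot> a \<cdot> x = x" "x \<cdot> b \<cdot> x = x"
    using assms by (auto simp: prec_def)
  have "x \<cdot> (a \<cdot> x \<cdot> b) \<cdot> x = x"
    using S eq by (metis assoc closed)
  then have 1: "prec x (a \<cdot> x \<cdot> b)" using S by (simp add: prec_def)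
  have 2: "prec (a \<cdot> x \<cdot> b) (b \<cdot> (a \<cdot> x))" using prec_mult_swap S by simp
  have 3: "prec (b \<cdot> (a \<cdot> x)) (b \<cdot> a)" using prec_mult_left[of "b \<cdot> a" x] S by (simp add: assoc)
  have 4: "prec (b \<cdot> a) (a \<cdot> b)" using prec_mult_swap S by simp
  show ?thesis using 1 2 3 4 prec_trans by blast
qed

text \<open>
  Equivalence classes of the preorder are rectangular bands; the middle factor may even come from a
  higher class.
\<close>

lemma rectangular:
  assumes "prec a d" "prec a b" "prec b a"
  shows "a \<cdot> d \<cdot> b = a \<cdot> b"
proof -
  have S: "a \<in> S" "b \<in> S" "d \<in> S" using assms by (auto simp: prec_def)
  have "a \<cdot> (d \<cdot> b) \<cdot> a = a" "b \<cdot> a \<cdot> b = b"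
    using prec_mult[of a d b] assms by (auto simp: prec_def)
  then show ?thesis using S by (metis assoc closed)
qed

end

section \<open>The natural preorder and the natural partial order\<close>

context skew_lattice
begin

text \<open>
  A skew lattice has two symmetries, the exchange of the operations and the reversal of the
  arguments of both. Dual versions of lemmas are instances of the originals along them.
\<close>

lemma dual: "skew_lattice S join meet"
  by unfold_locales
    (simp_all add: meet_closed join_closed meet_assoc join_assoc meet_idem join_idem
      meet_join_absorb_left meet_join_absorb_right join_meet_absorb_left join_meet_absorb_right)

lemma opposite: "skew_lattice S (\<lambda>x y. y \<sqinter> x) (\<lambda>x y. y \<squnion> x)"
  by unfold_locales
    (simp_all add: meet_closed join_closed meet_assoc join_assoc meet_idem join_idem
      meet_join_absorb_left meet_join_absorb_right join_meet_absorb_left join_meet_absorb_right)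

lemma meet_band: "band_on S meet"
  by unfold_locales (simp_all add: meet_closed meet_assoc meet_idem)

lemma join_band: "band_on S join"
  by unfold_locales (simp_all add: join_closed join_assoc join_idem)

lemmas closed [simp, intro] = meet_closed join_closed
lemmas idem [simp] = meet_idem join_idem

text \<open>
  Both relations include membership in the carrier, so that a comparison carries the typing facts
  needed for rewriting, and both are stated through the meet. The exchange of operations reverses
  them.
\<close>

definition prec :: "'a \<Rightarrow> 'a \<Rightarrow> bool" (infix "\<preceq>" 50) where
  "a \<preceq> b \<longleftrightarrow> a \<in> S \<and> b \<in> S \<and> a \<sqinter> b \<sqinter> a = a"

definition leq :: "'a \<Rightarrow> 'a \<Rightarrow> bool" (infix "\<le>\<^sub>S" 50) where
  "a \<le>\<^sub>S b \<longleftrightarrow> a \<in> S \<and> b \<in> S \<and> a \<sqinter> b = a \<and> b \<sqinter> a = a"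

lemma meet_eq_left_iff: "\<lbrakk>a \<in> S; b \<in> S\<rbrakk> \<Longrightarrow> a \<sqinter> b = a \<longleftrightarrow> a \<squnion> b = b"
  by (metis join_meet_absorb_right meet_join_absorb_left)

lemma meet_eq_right_iff: "\<lbrakk>a \<in> S; b \<in> S\<rbrakk> \<Longrightarrow> a \<sqinter> b = b \<longleftrightarrow> a \<squnion> b = a"
  by (metis join_meet_absorb_left meet_join_absorb_right)

text \<open>
  The two forms of the preorder agree: the join equation turns \<open>b \<sqinter> (a \<squnion> b)\<close> into \<open>a \<squnion> b\<close>, so that
  the absorption law \<open>a = a \<sqinter> (a \<squnion> b)\<close> exhibits \<open>b\<close> as a factor of \<open>a\<close> in the meet band.
\<close>

lemma meet_absorb_of_join_absorb:
  assumes S: "a \<in> S" "b \<in> S" and eq: "b \<squnion> a \<squnion> b = b"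
  shows "a \<sqinter> b \<sqinter> a = a"
proof -
  interpret M: band_on S meet by (rule meet_band)
  have "b \<squnion> (a \<squnion> b) = b" using S eq by (simp add: join_assoc)
  then have "b \<sqinter> (a \<squnion> b) = a \<squnion> b"
    using meet_eq_right_iff S by blast
  then have "a = a \<sqinter> b \<sqinter> (a \<squnion> b)"
    using meet_join_absorb_left S by (metis meet_assoc meet_closed join_closed)
  then show ?thesis
    using M.absorb_of_factor S by blast
qed

lemma prec_iff_join: "a \<preceq> b \<longleftrightarrow> a \<in> S \<and> b \<in> S \<and> b \<squnion> a \<squnion> b = b"
  using meet_absorb_of_join_absorb skew_lattice.meet_absorb_of_join_absorb[OF dual]
  unfolding prec_def by blast

lemma dual_prec [simp]: "skew_lattice.prec S join a b \<longleftrightarrow> b \<preceq> a"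
  using skew_lattice.prec_def[OF dual] prec_iff_join by blast

lemma dual_leq [simp]: "skew_lattice.leq S join a b \<longleftrightarrow> b \<le>\<^sub>S a"
  using skew_lattice.leq_def[OF dual] meet_eq_left_iff meet_eq_right_iff leq_def by metis

lemma natural_ge_iff: "\<lbrakk>a \<in> S; b \<in> S\<rbrakk> \<Longrightarrow> natural_ge join a b \<longleftrightarrow> b \<preceq> a"
  by (simp add: natural_ge_def prec_iff_join)

lemma band_prec: "band_on.prec S meet = (\<preceq>)"
  by (simp add: fun_eq_iff prec_def band_on.prec_def[OF meet_band])

lemma precD: "a \<preceq> b \<Longrightarrow> a \<in> S" "a \<preceq> b \<Longrightarrow> b \<in> S"
  by (auto simp: prec_def)

lemmas prec_refl [simp, intro] = band_on.prec_refl[OF meet_band, unfolded band_prec]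
  and prec_trans [trans] = band_on.prec_trans[OF meet_band, unfolded band_prec]
  and meet_prec1 [simp, intro] = band_on.prec_mult_left[OF meet_band, unfolded band_prec]
  and meet_prec2 [simp, intro] = band_on.prec_mult_right[OF meet_band, unfolded band_prec]
  and prec_meet = band_on.prec_mult[OF meet_band, unfolded band_prec]
  and meet_rectangular = band_on.rectangular[OF meet_band, unfolded band_prec]

lemmas prec_join1 [simp, intro] = skew_lattice.meet_prec1[OF dual, unfolded dual_prec]
  and prec_join2 [simp, intro] = skew_lattice.meet_prec2[OF dual, unfolded dual_prec]
  and join_prec = skew_lattice.prec_meet[OF dual, unfolded dual_prec]

lemma prec_meet_iff: "\<lbrakk>a \<in> S; b \<in> S\<rbrakk> \<Longrightarrow> c \<preceq> a \<sqinter> b \<longleftrightarrow> c \<preceq> a \<and> c \<preceq> b"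
  by (meson prec_meet meet_prec1 meet_prec2 prec_trans)

lemma join_prec_iff: "\<lbrakk>a \<in> S; b \<in> S\<rbrakk> \<Longrightarrow> a \<squnion> b \<preceq> c \<longleftrightarrow> a \<preceq> c \<and> b \<preceq> c"
  by (meson join_prec prec_join1 prec_join2 prec_trans)

lemma meet_precI: "\<lbrakk>a \<in> S; b \<in> S; a \<preceq> c \<or> b \<preceq> c\<rbrakk> \<Longrightarrow> a \<sqinter> b \<preceq> c"
  by (meson meet_prec1 meet_prec2 prec_trans)

lemma prec_joinI: "\<lbrakk>a \<in> S; b \<in> S; c \<preceq> a \<or> c \<preceq> b\<rbrakk> \<Longrightarrow> c \<preceq> a \<squnion> b"
  by (meson prec_join1 prec_join2 prec_trans)

lemma leqD: "a \<le>\<^sub>S b \<Longrightarrow> a \<in> S" "a \<le>\<^sub>S b \<Longrightarrow> b \<in> S"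
  by (auto simp: leq_def)

lemma leq_iff_join: "a \<le>\<^sub>S b \<longleftrightarrow> a \<in> S \<and> b \<in> S \<and> a \<squnion> b = b \<and> b \<squnion> a = b"
  using meet_eq_left_iff meet_eq_right_iff leq_def by metis

lemma leq_antisym_prec:
  assumes "a \<le>\<^sub>S b" "b \<preceq> a"
  shows "a = b"
  using assms by (metis leq_def prec_def)

text \<open>
  On a \<open>\<D>\<close>-class the join is the meet with reversed arguments: \<open>b \<squnion> a\<close> is fixed by \<open>a\<close> on the left and
  by \<open>b\<close> on the right, and the class is rectangular.
\<close>

lemma D_meet_eq_join:
  assumes ab: "a \<preceq> b" and ba: "b \<preceq> a"
  shows "a \<sqinter> b = b \<squnion> a"
proof -
  have S: "a \<in> S" "b \<in> S" using ab precD by auto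
  have "a \<squnion> b \<squnion> a = a" "b \<squnion> a \<squnion> b = b"
    using ab ba by (auto simp: prec_iff_join)
  then have "a \<sqinter> (b \<squnion> a) = b \<squnion> a" "(b \<squnion> a) \<sqinter> b = b \<squnion> a"
    using S meet_eq_right_iff meet_eq_left_iff by (metis join_assoc join_closed)+
  then have "a \<sqinter> (b \<squnion> a) \<sqinter> b = b \<squnion> a" by simp
  moreover have "a \<sqinter> (b \<squnion> a) \<sqinter> b = a \<sqinter> b"
    using meet_rectangular[of a "b \<squnion> a" b] S ab ba by simp
  ultimately show ?thesis by simp
qed

section \<open>Regularity\<close>

text \<open>
  The hypotheses say that \<open>x\<close> and \<open>s\<close> are \<open>\<R>\<close>-related in the meet band and that \<open>s\<close> is a right identity
  for \<open>b\<close>. The element \<open>s \<squnion> b\<close> links them: it satisfies \<open>(s \<squnion> b) \<sqinter> b = b\<close> by absorption, and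
  \<open>x \<sqinter> (s \<squnion> b) = s\<close> because \<open>s \<sqinter> (s \<squnion> b) = s\<close> and the class of \<open>s\<close> is rectangular.
  This is the step towards regularity in which the join enters; a band alone need not be regular.
\<close>

lemma R_related_act_equally:
  assumes S: "x \<in> S" "s \<in> S" and R: "x \<sqinter> s = s" "s \<sqinter> x = x" and b: "b \<in> S" "b \<sqinter> s = b"
  shows "x \<sqinter> b = s \<sqinter> b"
proof -
  define s1 where "s1 = s \<squnion> b"
  have s1: "s1 \<in> S" using S b by (simp add: s1_def)
  have "b \<preceq> s" using meet_prec2[of b s] b S by simp
  then have D: "s1 \<preceq> s" "s \<preceq> s1"
    using S b by (simp_all add: s1_def join_prec_iff)
  have xs: "x \<preceq> s" "s \<preceq> x" using S R by (auto simp: prec_def)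
  have "s1 \<sqinter> b = b" using S b by (simp add: s1_def meet_join_absorb_right)
  moreover have "x \<sqinter> s1 = s"
  proof -
    have "x \<sqinter> s1 = x \<sqinter> s \<sqinter> s1"
      using meet_rectangular[of x s s1] xs(1) prec_trans[OF xs(1) D(2)] prec_trans[OF D(1) xs(2)]
      by simp
    also have "\<dots> = s"
      using S b R by (simp add: s1_def meet_join_absorb_left)
    finally show ?thesis .
  qed
  ultimately show ?thesis using S s1 b by (metis meet_assoc)
qed

lemma R_related_sandwich:
  assumes S: "x \<in> S" "y \<in> S" "z \<in> S" and R: "x \<sqinter> y = y" "y \<sqinter> x = x"
  shows "x \<sqinter> (z \<sqinter> y) = y \<sqinter> (z \<sqinter> y)"
  using R_related_act_equally[of x y "z \<sqinter> y"] assms by (simp add: meet_assoc)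

lemma L_related_sandwich:
  assumes S: "x \<in> S" "y \<in> S" "z \<in> S" and R: "y \<sqinter> x = y" "x \<sqinter> y = x"
  shows "y \<sqinter> z \<sqinter> x = y \<sqinter> z \<sqinter> y"
  using skew_lattice.R_related_sandwich[OF opposite, of x y z] assms by simp

text \<open>
  Kimura's regularity law, as the statement that \<open>b \<mapsto> a \<sqinter> b \<sqinter> a\<close> preserves meets. The elements \<open>a \<sqinter> b\<close>
  and \<open>a \<sqinter> b \<sqinter> a\<close> are \<open>\<R>\<close>-related and \<open>c \<sqinter> a\<close> and \<open>a \<sqinter> c \<sqinter> a\<close> are \<open>\<L>\<close>-related; replacing one by the
  other shows that the left side is below the right side. They have the same factors, so they are
  also equivalent.
\<close>

lemma meet_regular:
  assumes S: "a \<in> S" "b \<in> S" "c \<in> S"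
  shows "(a \<sqinter> b \<sqinter> a) \<sqinter> (a \<sqinter> c \<sqinter> a) = a \<sqinter> b \<sqinter> c \<sqinter> a"
proof -
  define p q where "p = (a \<sqinter> b \<sqinter> a) \<sqinter> (a \<sqinter> c \<sqinter> a)" and "q = a \<sqinter> b \<sqinter> c \<sqinter> a"
  interpret M: band_on S meet by (rule meet_band)
  have pq: "p \<in> S" "q \<in> S" using S by (simp_all add: p_def q_def)
  have pp: "a \<sqinter> (b \<sqinter> (a \<sqinter> (c \<sqinter> (a \<sqinter> (b \<sqinter> (a \<sqinter> (c \<sqinter> a))))))) = p"
    using meet_idem[OF pq(1)] S by (simp add: p_def meet_assoc del: idem M.idem)
  have "(a \<sqinter> b) \<sqinter> (c \<sqinter> (a \<sqinter> b \<sqinter> a)) = (a \<sqinter> b \<sqinter> a) \<sqinter> (c \<sqinter> (a \<sqinter> b \<sqinter> a))"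
    by (rule R_related_sandwich) (use S in \<open>simp_all add: meet_assoc\<close>)
  then have "(a \<sqinter> b) \<sqinter> (c \<sqinter> (a \<sqinter> b \<sqinter> a)) \<sqinter> (c \<sqinter> a)
    = (a \<sqinter> b \<sqinter> a) \<sqinter> (c \<sqinter> (a \<sqinter> b \<sqinter> a)) \<sqinter> (c \<sqinter> a)" by simp
  moreover have "(a \<sqinter> b \<sqinter> a) \<sqinter> (c \<sqinter> (a \<sqinter> b \<sqinter> a)) \<sqinter> (c \<sqinter> a) = p"
    using S pp by (simp add: meet_assoc)
  ultimately have qp: "q \<sqinter> p = p"
    using S by (simp add: meet_assoc p_def q_def)
  have "(a \<sqinter> c \<sqinter> a) \<sqinter> b \<sqinter> (c \<sqinter> a) = (a \<sqinter> c \<sqinter> a) \<sqinter> b \<sqinter> (a \<sqinter> c \<sqinter> a)"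
    by (rule L_related_sandwich) (use S in \<open>simp_all add: meet_assoc\<close>)
  then have "(a \<sqinter> b) \<sqinter> ((a \<sqinter> c \<sqinter> a) \<sqinter> b \<sqinter> (c \<sqinter> a)) = (a \<sqinter> b) \<sqinter> ((a \<sqinter> c \<sqinter> a) \<sqinter> b \<sqinter> (a \<sqinter> c \<sqinter> a))"
    by simp
  moreover have "(a \<sqinter> b) \<sqinter> ((a \<sqinter> c \<sqinter> a) \<sqinter> b \<sqinter> (a \<sqinter> c \<sqinter> a)) = p"
    using S pp by (simp add: meet_assoc)
  ultimately have "p \<sqinter> q = p"
    using S by (simp add: meet_assoc p_def q_def)
  then have "p \<le>\<^sub>S q" using qp pq by (simp add: leq_def)
  moreover have "q \<preceq> p"
    unfolding p_def q_def using S by (simp add: prec_meet_iff meet_precI)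
  ultimately show ?thesis unfolding p_def[symmetric] q_def[symmetric] by (rule leq_antisym_prec)
qed

section \<open>Sandwich maps\<close>

lemma sandwich_leq: "\<lbrakk>x \<in> S; a \<in> S\<rbrakk> \<Longrightarrow> x \<sqinter> a \<sqinter> x \<le>\<^sub>S x"
  by (simp add: leq_def meet_assoc, simp flip: meet_assoc)

lemma sandwich_mono:
  assumes "x \<in> S" "a \<le>\<^sub>S b"
  shows "x \<sqinter> a \<sqinter> x \<le>\<^sub>S x \<sqinter> b \<sqinter> x"
  using assms meet_regular[of x a b] meet_regular[of x b a] leqD[OF assms(2)]
  by (simp add: leq_def meet_assoc)

text \<open>
  The sandwich of \<open>w\<close> by \<open>x\<close> does not change when \<open>w\<close> is shrunk to any smaller element above the class of
  \<open>x \<sqinter> w\<close>. This is how incomparable elements are replaced by elements of a common chain.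
\<close>

lemma sandwich_eq:
  assumes "x \<in> S" "t \<le>\<^sub>S w" "x \<sqinter> w \<preceq> t"
  shows "x \<sqinter> w \<sqinter> x = x \<sqinter> t \<sqinter> x"
proof -
  have "x \<sqinter> w \<sqinter> x \<preceq> x \<sqinter> t \<sqinter> x"
    using assms leqD[OF assms(2)] by (simp add: prec_meet_iff meet_precI)
  then show ?thesis using leq_antisym_prec sandwich_mono assms by metis
qed

lemmas join_sandwich_geq = skew_lattice.sandwich_leq[OF dual, unfolded dual_leq]
  and join_sandwich_mono = skew_lattice.sandwich_mono[OF dual, unfolded dual_leq]

text \<open>
  Regularity distributes the outer \<open>a\<close> over the three inner factors, and \<open>a\<close> absorbs \<open>b\<close>.
\<close>

lemma sandwich_sandwich:
  assumes "a \<preceq> b" "r \<in> S"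
  shows "a \<sqinter> (b \<sqinter> r \<sqinter> b) \<sqinter> a = a \<sqinter> r \<sqinter> a"
proof -
  have S: "a \<in> S" "b \<in> S" "r \<in> S" and ab: "a \<sqinter> b \<sqinter> a = a"
    using assms by (auto simp: prec_def)
  have "a \<sqinter> (b \<sqinter> r \<sqinter> b) \<sqinter> a = (a \<sqinter> b \<sqinter> a) \<sqinter> (a \<sqinter> r \<sqinter> a) \<sqinter> (a \<sqinter> b \<sqinter> a)"
    using S meet_regular[of a b r] meet_regular[of a "b \<sqinter> r" b] by (simp add: meet_assoc)
  then show ?thesis
    using S sandwich_leq[of a r] unfolding ab by (simp add: leq_def)
qed

lemma meet_common_lower_bound:
  assumes "n \<le>\<^sub>S a" "n \<le>\<^sub>S b" "a \<sqinter> b \<preceq> n"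
  shows "a \<sqinter> b = n"
proof -
  have "n \<le>\<^sub>S a \<sqinter> b"
    using assms(1,2) by (simp add: leq_def meet_assoc, simp flip: meet_assoc)
  then show ?thesis using leq_antisym_prec assms(3) by metis
qed

text \<open>
  Both meets are equal to \<open>n\<close>. This produces the commuting pairs to which upper symmetry is applied.
\<close>

lemma meet_commute_of_common_lower_bound:
  assumes "n \<le>\<^sub>S a" "n \<le>\<^sub>S b" "a \<sqinter> b \<preceq> n"
  shows "a \<sqinter> b = b \<sqinter> a"
proof -
  have "b \<sqinter> a \<preceq> a \<sqinter> b" using leqD assms by (simp add: prec_meet_iff)
  then show ?thesis using meet_common_lower_bound assms prec_trans by metis
qed

lemma leq_join_of_commute:
  assumes S: "a \<in> S" "b \<in> S" and comm: "a \<squnion> b = b \<squnion> a"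
  shows "a \<le>\<^sub>S a \<squnion> b"
proof -
  have "a \<squnion> (a \<squnion> b) = a \<squnion> b" using S by (simp flip: join_assoc)
  moreover have "(a \<squnion> b) \<squnion> a = a \<squnion> b" unfolding comm using S by (simp add: join_assoc)
  ultimately show ?thesis using S by (simp add: leq_iff_join)
qed

text \<open>
  The two factors are equivalent, so their meet is their join in the opposite order, which collapses
  by idempotence.
\<close>

lemma join_factor:
  assumes S: "y \<in> S" "z \<in> S"
  shows "(z \<squnion> y \<squnion> z) \<sqinter> (y \<squnion> z \<squnion> y) = y \<squnion> z"
proof -
  interpret J: band_on S join by (rule join_band)
  have "(z \<squnion> y \<squnion> z) \<sqinter> (y \<squnion> z \<squnion> y) = (y \<squnion> z \<squnion> y) \<squnion> (z \<squnion> y \<squnion> z)"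
    by (rule D_meet_eq_join) (use S in \<open>simp_all add: join_prec_iff prec_joinI\<close>)
  also have "\<dots> = y \<squnion> z" using S by (simp add: join_assoc)
  finally show ?thesis .
qed

text \<open>
  The sandwiched joins \<open>z \<squnion> y \<squnion> z\<close> and \<open>y \<squnion> z \<squnion> y\<close> are the meet factors of \<open>y \<squnion> z\<close>, and sandwich maps
  preserve meets.
\<close>

lemma meet_distributive_if_sandwich:
  assumes "\<And>x y z. \<lbrakk>x \<in> S; y \<in> S; z \<in> S\<rbrakk> \<Longrightarrow>
    x \<sqinter> (y \<squnion> z \<squnion> y) \<sqinter> x = (x \<sqinter> y \<sqinter> x) \<squnion> (x \<sqinter> z \<sqinter> x) \<squnion> (x \<sqinter> y \<sqinter> x)"
  shows "meet_distributive S meet join"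
  unfolding meet_distributive_def
proof (intro ballI)
  fix x y z assume S: "x \<in> S" "y \<in> S" "z \<in> S"
  have "x \<sqinter> (y \<squnion> z) \<sqinter> x = x \<sqinter> ((z \<squnion> y \<squnion> z) \<sqinter> (y \<squnion> z \<squnion> y)) \<sqinter> x"
    using join_factor S by simp
  also have "\<dots> = (x \<sqinter> (z \<squnion> y \<squnion> z) \<sqinter> x) \<sqinter> (x \<sqinter> (y \<squnion> z \<squnion> y) \<sqinter> x)"
    using meet_regular[of x "z \<squnion> y \<squnion> z" "y \<squnion> z \<squnion> y"] S by (simp add: meet_assoc)
  also have "\<dots> = (x \<sqinter> y \<sqinter> x) \<squnion> (x \<sqinter> z \<sqinter> x)"
    using join_factor S by (simp add: assms)
  finally show "x \<sqinter> (y \<squnion> z) \<sqinter> x = (x \<sqinter> y \<sqinter> x) \<squnion> (x \<sqinter> z \<sqinter> x)" .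
qed

lemma dual_meet_distributive: "meet_distributive S join meet \<longleftrightarrow> join_distributive S meet join"
  by (simp add: meet_distributive_def join_distributive_def)

lemma join_distributive_if_sandwich:
  assumes "\<And>x y z. \<lbrakk>x \<in> S; y \<in> S; z \<in> S\<rbrakk> \<Longrightarrow>
    x \<squnion> (y \<sqinter> z \<sqinter> y) \<squnion> x = (x \<squnion> y \<squnion> x) \<sqinter> (x \<squnion> z \<squnion> x) \<sqinter> (x \<squnion> y \<squnion> x)"
  shows "join_distributive S meet join"
  using skew_lattice.meet_distributive_if_sandwich[OF dual] assms dual_meet_distributive by blast

lemma prec_sandwichD: "a \<preceq> b \<Longrightarrow> a \<sqinter> b \<sqinter> a = a" "a \<preceq> b \<Longrightarrow> b \<squnion> a \<squnion> b = b"
  using prec_def prec_iff_join by blast+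

section \<open>Totally preordered skew lattices\<close>

text \<open>
  The dual sandwiched law is immediate unless \<open>x \<preceq> z \<preceq> y\<close>. In that case both sides lie below
  \<open>Y = x \<squnion> y \<squnion> x\<close>, which is equivalent to \<open>y\<close>, so they can be recovered from their sandwiches by \<open>y\<close>. On those, \<open>\<sqinter>\<close>-distributivity
  applies to both sides and gives the same expression.
\<close>

lemma join_distributive_if_total:
  assumes total: "\<And>a b. \<lbrakk>a \<in> S; b \<in> S\<rbrakk> \<Longrightarrow> a \<preceq> b \<or> b \<preceq> a"
    and md: "meet_distributive S meet join"
  shows "join_distributive S meet join"
proof (rule join_distributive_if_sandwich)
  fix x y z assume S: "x \<in> S" "y \<in> S" "z \<in> S"
  define Y where "Y = x \<squnion> y \<squnion> x"
  have YS: "Y \<in> S" using S by (simp add: Y_def)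
  consider "y \<preceq> z" | "z \<preceq> y" "y \<preceq> x" | "x \<preceq> y" "z \<preceq> x" | "z \<preceq> y" "x \<preceq> y" "x \<preceq> z"
    using total S by blast
  then have "x \<squnion> (y \<sqinter> z \<sqinter> y) \<squnion> x = Y \<sqinter> (x \<squnion> z \<squnion> x) \<sqinter> Y"
  proof cases
    case 1
    then have "Y \<preceq> x \<squnion> z \<squnion> x" using S by (simp add: Y_def join_prec_iff prec_joinI)
    then show ?thesis using 1 by (simp add: prec_sandwichD Y_def)
  next
    case 2
    then have "y \<sqinter> z \<sqinter> y \<preceq> x" "z \<preceq> x" using S by (auto intro: meet_precI prec_trans)
    then show ?thesis using 2 S by (simp add: prec_sandwichD Y_def)
  next
    case 3
    then have "y \<sqinter> z \<sqinter> y \<preceq> x" using S by (simp add: meet_precI)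
    moreover have "Y \<sqinter> x \<sqinter> Y = x"
      using join_sandwich_geq[of x y] S by (simp add: Y_def leq_def)
    ultimately show ?thesis using 3 by (simp add: prec_sandwichD)
  next
    case 4
    define p q where "p = x \<squnion> (y \<sqinter> z \<sqinter> y) \<squnion> x" and "q = Y \<sqinter> (x \<squnion> z \<squnion> x) \<sqinter> Y"
    have pq: "p \<in> S" "q \<in> S" using S YS by (simp_all add: p_def q_def)
    have Yy: "Y \<preceq> y" "y \<preceq> Y" using 4 S by (simp_all add: Y_def join_prec_iff prec_joinI)
    have dist: "y \<sqinter> (a \<squnion> b) \<sqinter> y = (y \<sqinter> a \<sqinter> y) \<squnion> (y \<sqinter> b \<sqinter> y)" if "a \<in> S" "b \<in> S" for a b
      using md S that by (simp add: meet_distributive_def)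
    have "y \<sqinter> p \<sqinter> y = (y \<sqinter> x \<sqinter> y) \<squnion> (y \<sqinter> z \<sqinter> y) \<squnion> (y \<sqinter> x \<sqinter> y)"
      using S sandwich_sandwich[of y y z] by (simp add: p_def dist)
    moreover have "y \<sqinter> q \<sqinter> y = (y \<sqinter> x \<sqinter> y) \<squnion> (y \<sqinter> z \<sqinter> y) \<squnion> (y \<sqinter> x \<sqinter> y)"
      using S Yy sandwich_sandwich[of y Y "x \<squnion> z \<squnion> x"] by (simp add: q_def dist)
    \<comment> \<open>Going from \<open>Y\<close> to \<open>y\<close> and back loses nothing, because the two are equivalent.\<close>
    ultimately have "Y \<sqinter> (y \<sqinter> p \<sqinter> y) \<sqinter> Y = Y \<sqinter> (y \<sqinter> q \<sqinter> y) \<sqinter> Y"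
      by simp
    then have "Y \<sqinter> p \<sqinter> Y = Y \<sqinter> q \<sqinter> Y"
      using sandwich_sandwich Yy pq by simp
    moreover have "p \<le>\<^sub>S Y"
      unfolding p_def Y_def using S sandwich_leq[of y z] by (intro join_sandwich_mono) auto
    moreover have "q \<le>\<^sub>S Y" using sandwich_leq S YS by (simp add: q_def)
    ultimately show ?thesis by (simp add: leq_def flip: p_def q_def)
  qed
  then show "x \<squnion> (y \<sqinter> z \<sqinter> y) \<squnion> x = (x \<squnion> y \<squnion> x) \<sqinter> (x \<squnion> z \<squnion> x) \<sqinter> (x \<squnion> y \<squnion> x)"
    by (simp add: Y_def)
qed

lemma subalgebra_skew_lattice:
  assumes "subalgebra S meet join T"
  shows "skew_lattice T meet join"
proof -
  have T: "x \<in> S" "y \<in> T \<Longrightarrow> x \<sqinter> y \<in> T" "y \<in> T \<Longrightarrow> x \<squnion> y \<in> T" if "x \<in> T" for x y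
    using that assms by (auto simp: subalgebra_def)
  show ?thesis
    by unfold_locales
      (simp_all add: T meet_assoc join_assoc
        meet_join_absorb_left meet_join_absorb_right join_meet_absorb_left join_meet_absorb_right)
qed

lemma linearly_distributive_if_meet_distributive:
  assumes "meet_distributive S meet join"
  shows "linearly_distributive S meet join"
  unfolding linearly_distributive_def
proof (intro allI impI)
  fix T
  assume T: "subalgebra S meet join T \<and> (\<forall>a\<in>T. \<forall>b\<in>T. natural_ge join a b \<or> natural_ge join b a)"
  then interpret T: skew_lattice T meet join using subalgebra_skew_lattice by blast
  have "T \<subseteq> S" using T by (simp add: subalgebra_def)
  then have "meet_distributive T meet join"
    using assms unfolding meet_distributive_def by blast
  moreover have "join_distributive T meet join"
    by (rule T.join_distributive_if_total) (use T T.natural_ge_iff calculation in blast)+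
  ultimately show "skew_distributive T meet join" by (simp add: skew_distributive_def)
qed

section \<open>The lattice of \<open>\<D>\<close>-classes\<close>

text \<open>
  Quasi-distributivity without the quotient. Only one inequality is recorded, since the reverse one
  holds in every lattice.
\<close>

definition prec_distributive :: bool where
  "prec_distributive \<longleftrightarrow> (\<forall>a\<in>S. \<forall>b\<in>S. \<forall>c\<in>S. a \<sqinter> (b \<squnion> c) \<preceq> (a \<sqinter> b) \<squnion> (a \<sqinter> c))"

lemma D_rel_iff: "(a, b) \<in> D_rel S join \<longleftrightarrow> a \<preceq> b \<and> b \<preceq> a"
  using natural_ge_iff precD by (auto simp: D_rel_def)

lemma equiv_D_rel: "equiv S (D_rel S join)"
proof (rule equivI)
  show "D_rel S join \<subseteq> S \<times> S" by (auto simp: D_rel_def)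
  show "refl_on S (D_rel S join)" by (auto simp: refl_on_def D_rel_iff)
  show "sym (D_rel S join)" by (auto simp: sym_def D_rel_iff)
  show "trans (D_rel S join)" by (auto simp: trans_def D_rel_iff intro: prec_trans)
qed

abbreviation D_class :: "'a \<Rightarrow> 'a set" where
  "D_class a \<equiv> D_rel S join `` {a}"

lemma D_class_eq_iff: "\<lbrakk>a \<in> S; b \<in> S\<rbrakk> \<Longrightarrow> D_class a = D_class b \<longleftrightarrow> a \<preceq> b \<and> b \<preceq> a"
  using eq_equiv_class_iff[OF equiv_D_rel] D_rel_iff by simp

lemma quotient_op_D_class:
  assumes S: "a \<in> S" "b \<in> S"
    and cong: "\<And>a' b'. \<lbrakk>a' \<preceq> a; a \<preceq> a'; b' \<preceq> b; b \<preceq> b'\<rbrakk> \<Longrightarrow> D_class (f a' b') = D_class (f a b)"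
  shows "quotient_op (D_rel S join) f (D_class a) (D_class b) = D_class (f a b)"
proof -
  have "D_class (f a' b') = D_class (f a b)" if "a' \<in> D_class a" "b' \<in> D_class b" for a' b'
    using that cong by (simp add: D_rel_iff)
  moreover have "a \<in> D_class a" "b \<in> D_class b" using S by (auto simp: D_rel_iff)
  ultimately show ?thesis unfolding quotient_op_def by blast
qed

lemma quotient_meet_D_class:
  assumes "a \<in> S" "b \<in> S"
  shows "quotient_op (D_rel S join) meet (D_class a) (D_class b) = D_class (a \<sqinter> b)"
  using assms
  by (intro quotient_op_D_class) (auto simp: D_class_eq_iff precD prec_meet_iff intro: meet_precI)

lemma quotient_join_D_class:
  assumes "a \<in> S" "b \<in> S"
  shows "quotient_op (D_rel S join) join (D_class a) (D_class b) = D_class (a \<squnion> b)"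
  using assms
  by (intro quotient_op_D_class) (auto simp: D_class_eq_iff precD join_prec_iff intro: prec_joinI)

lemma quasi_distributive_iff: "quasi_distributive S meet join \<longleftrightarrow> prec_distributive"
proof
  assume "quasi_distributive S meet join"
  then interpret Q: distributive_lattice_on "S // D_rel S join"
      "quotient_op (D_rel S join) meet" "quotient_op (D_rel S join) join"
    by (simp add: quasi_distributive_def)
  show prec_distributive
    unfolding prec_distributive_def
  proof (intro ballI)
    fix a b c assume S: "a \<in> S" "b \<in> S" "c \<in> S"
    then show "a \<sqinter> (b \<squnion> c) \<preceq> (a \<sqinter> b) \<squnion> (a \<sqinter> c)"
      using Q.meet_join_distrib[of "D_class a" "D_class b" "D_class c"]
      by (simp add: quotientI quotient_meet_D_class quotient_join_D_class D_class_eq_iff)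
  qed
next
  assume dist: prec_distributive
  show "quasi_distributive S meet join"
    unfolding quasi_distributive_def
    by (unfold_locales; elim quotientE;
        simp add: quotient_meet_D_class quotient_join_D_class quotientI meet_assoc join_assoc
          meet_join_absorb_left join_meet_absorb_left;
        simp add: D_class_eq_iff)
      (use dist in \<open>simp_all add: prec_distributive_def prec_meet_iff join_prec_iff prec_joinI meet_precI\<close>)
qed

lemma prec_distributive_if_meet_distributive:
  assumes "meet_distributive S meet join"
  shows prec_distributive
  unfolding prec_distributive_def
proof (intro ballI)
  fix a b c assume S: "a \<in> S" "b \<in> S" "c \<in> S"
  have "a \<sqinter> (b \<squnion> c) \<preceq> a \<sqinter> (b \<squnion> c) \<sqinter> a" using S by (simp add: prec_meet_iff)
  also have "\<dots> = (a \<sqinter> b \<sqinter> a) \<squnion> (a \<sqinter> c \<sqinter> a)"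
    using assms S by (simp add: meet_distributive_def)
  also have "\<dots> \<preceq> (a \<sqinter> b) \<squnion> (a \<sqinter> c)"
    using S by (simp add: join_prec_iff prec_joinI)
  finally show "a \<sqinter> (b \<squnion> c) \<preceq> (a \<sqinter> b) \<squnion> (a \<sqinter> c)" .
qed

text \<open>
  The usual proof that one distributive law of a lattice implies the other, carried out in the
  preorder.
\<close>

lemma prec_distributive_dual:
  assumes prec_distributive
  shows "skew_lattice.prec_distributive S join meet"
  unfolding skew_lattice.prec_distributive_def[OF dual] dual_prec
proof (intro ballI)
  fix a b c assume S: "a \<in> S" "b \<in> S" "c \<in> S"
  have dist: "p \<sqinter> (q \<squnion> r) \<preceq> (p \<sqinter> q) \<squnion> (p \<sqinter> r)" if "p \<in> S" "q \<in> S" "r \<in> S" for p q r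
    using assms that by (simp add: prec_distributive_def)
  have "(a \<squnion> b) \<sqinter> (a \<squnion> c) \<preceq> ((a \<squnion> b) \<sqinter> a) \<squnion> ((a \<squnion> b) \<sqinter> c)" using dist S by simp
  also have "\<dots> \<preceq> a \<squnion> (b \<sqinter> c)"
  proof -
    have "(a \<squnion> b) \<sqinter> c \<preceq> c \<sqinter> (a \<squnion> b)" using S by (simp add: prec_meet_iff)
    also have "\<dots> \<preceq> (c \<sqinter> a) \<squnion> (c \<sqinter> b)" using dist S by simp
    also have "\<dots> \<preceq> a \<squnion> (b \<sqinter> c)"
      using S by (simp add: join_prec_iff, simp add: prec_joinI prec_meet_iff)
    finally show ?thesis using S by (simp add: join_prec_iff, simp add: prec_joinI)
  qed
  finally show "(a \<squnion> b) \<sqinter> (a \<squnion> c) \<preceq> a \<squnion> (b \<sqinter> c)" .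
qed

lemma dual_quasi_distributive:
  "quasi_distributive S join meet \<longleftrightarrow> quasi_distributive S meet join"
  using prec_distributive_dual skew_lattice.prec_distributive_dual[OF dual]
    quasi_distributive_iff skew_lattice.quasi_distributive_iff[OF dual] by blast

section \<open>Distributivity along chains of \<open>\<D>\<close>-classes\<close>

text \<open>
  The elements equivalent to one of \<open>x, y, z\<close> form a totally preordered subalgebra: it is closed
  because the meet and the join of comparable elements are equivalent to the smaller and to the
  larger one.
\<close>

lemma chain_distributive:
  assumes lin: "linearly_distributive S meet join" and S: "x \<in> S" "y \<in> S" "z \<in> S"
    and chain: "x \<preceq> y \<or> y \<preceq> x" "x \<preceq> z \<or> z \<preceq> x" "y \<preceq> z \<or> z \<preceq> y"
  shows "x \<sqinter> (y \<squnion> z) \<sqinter> x = (x \<sqinter> y \<sqinter> x) \<squnion> (x \<sqinter> z \<sqinter> x)"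
proof -
  define T where "T = {t. \<exists>u\<in>{x, y, z}. t \<preceq> u \<and> u \<preceq> t}"
  have TS: "T \<subseteq> S" using precD by (auto simp: T_def)
  have total: "a \<preceq> b \<or> b \<preceq> a" if "a \<in> T" "b \<in> T" for a b
  proof -
    obtain u v where uv: "u \<in> {x, y, z}" "v \<in> {x, y, z}" "a \<preceq> u" "u \<preceq> a" "b \<preceq> v" "v \<preceq> b"
      using \<open>a \<in> T\<close> \<open>b \<in> T\<close> by (auto simp: T_def)
    have "u \<preceq> v \<or> v \<preceq> u" using chain uv(1,2) S by auto
    then show ?thesis using uv prec_trans by blast
  qed
  have saturated: "s \<in> T" if "t \<in> T" "s \<preceq> t" "t \<preceq> s" for s t
    using that prec_trans unfolding T_def by blast
  have "a \<sqinter> b \<in> T \<and> a \<squnion> b \<in> T" if ab: "a \<in> T" "b \<in> T" for a b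
  proof -
    have abS: "a \<in> S" "b \<in> S" using ab TS by auto
    show ?thesis
      using total[OF ab]
    proof
      assume le: "a \<preceq> b"
      show ?thesis
        using saturated[OF ab(1), of "a \<sqinter> b"] saturated[OF ab(2), of "a \<squnion> b"] le abS
        by (simp add: prec_meet_iff join_prec_iff)
    next
      assume le: "b \<preceq> a"
      show ?thesis
        using saturated[OF ab(2), of "a \<sqinter> b"] saturated[OF ab(1), of "a \<squnion> b"] le abS
        by (simp add: prec_meet_iff join_prec_iff)
    qed
  qed
  then have "subalgebra S meet join T" using TS by (auto simp: subalgebra_def)
  moreover have "\<forall>a\<in>T. \<forall>b\<in>T. natural_ge join a b \<or> natural_ge join b a"
    using total natural_ge_iff TS by (metis subsetD)
  ultimately have "meet_distributive T meet join"
    using lin by (auto simp: linearly_distributive_def skew_distributive_def)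
  moreover have "x \<in> T" "y \<in> T" "z \<in> T" using S by (auto simp: T_def)
  ultimately show ?thesis by (simp add: meet_distributive_def)
qed

text \<open>
  The exchange of operations reverses the natural preorder, which leaves the totally preordered
  subalgebras and their distributivity unchanged.
\<close>

lemma dual_linearly_distributive:
  "linearly_distributive S join meet \<longleftrightarrow> linearly_distributive S meet join"
proof -
  have ge: "natural_ge meet a b \<longleftrightarrow> natural_ge join b a" if "a \<in> S" "b \<in> S" for a b
    using natural_ge_iff skew_lattice.natural_ge_iff[OF dual] that by simp
  have sub: "subalgebra S join meet T \<longleftrightarrow> subalgebra S meet join T" for T
    by (auto simp: subalgebra_def)
  have dist: "skew_distributive T join meet \<longleftrightarrow> skew_distributive T meet join" for T
    by (auto simp: skew_distributive_def meet_distributive_def join_distributive_def)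
  have total: "(\<forall>a\<in>T. \<forall>b\<in>T. natural_ge meet a b \<or> natural_ge meet b a) \<longleftrightarrow>
      (\<forall>a\<in>T. \<forall>b\<in>T. natural_ge join a b \<or> natural_ge join b a)"
    if "subalgebra S meet join T" for T
  proof -
    have "natural_ge meet a b \<longleftrightarrow> natural_ge join b a" if "a \<in> T" "b \<in> T" for a b
      using ge that \<open>subalgebra S meet join T\<close> by (simp add: subalgebra_def subset_iff)
    then show ?thesis by (simp add: disj_commute)
  qed
  show ?thesis
    unfolding linearly_distributive_def sub dist using total by blast
qed

lemma sandwich_distrib_chain:
  assumes lin: "linearly_distributive S meet join" and c: "n \<preceq> t" "t \<preceq> x"
  shows "x \<sqinter> (n \<squnion> t \<squnion> n) \<sqinter> x = (x \<sqinter> n \<sqinter> x) \<squnion> (x \<sqinter> t \<sqinter> x) \<squnion> (x \<sqinter> n \<sqinter> x)"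
proof -
  have S: "n \<in> S" "t \<in> S" "x \<in> S" using c precD by auto
  have nx: "n \<preceq> x" using c prec_trans by blast
  have nt: "n \<squnion> t \<preceq> x" "n \<preceq> n \<squnion> t" using c nx S by (simp_all add: join_prec_iff)
  show ?thesis
    using chain_distributive[OF lin, of x "n \<squnion> t" n] chain_distributive[OF lin, of x n t]
      S c nx nt by simp
qed

lemma join_sandwich_distrib_chain:
  assumes lin: "linearly_distributive S meet join" and c: "m \<preceq> r" "r \<preceq> z"
  shows "m \<squnion> (z \<sqinter> r \<sqinter> z) \<squnion> m = (m \<squnion> z \<squnion> m) \<sqinter> (m \<squnion> r \<squnion> m) \<sqinter> (m \<squnion> z \<squnion> m)"
  using skew_lattice.sandwich_distrib_chain[OF dual, of z r m] lin c
  by (simp add: dual_linearly_distributive)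

section \<open>Distributing a sandwich over a join\<close>

text \<open>
  Here \<open>x\<close> and \<open>z\<close> may be incomparable, but each of them forms a chain with \<open>x \<sqinter> z\<close> and \<open>m\<close>. Along
  \<open>z, x \<sqinter> z, m\<close> the \<open>\<squnion>\<close>-distributive law shows that \<open>t = m \<squnion> (z \<sqinter> (x \<sqinter> z) \<sqinter> z) \<squnion> m\<close> is below
  \<open>w = m \<squnion> z \<squnion> m\<close>. As \<open>t\<close> is still above the class of \<open>x \<sqinter> z\<close>, it has the same sandwich by \<open>x\<close> as \<open>w\<close>,
  and along \<open>x, x \<sqinter> z, m\<close> the \<open>\<sqinter>\<close>-distributive law applies to it.
\<close>

lemma sandwich_distrib_lower_bound:
  assumes lin: "linearly_distributive S meet join" and c: "m \<preceq> x" "m \<preceq> z"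
  shows "x \<sqinter> (m \<squnion> z \<squnion> m) \<sqinter> x = (x \<sqinter> m \<sqinter> x) \<squnion> (x \<sqinter> z \<sqinter> x) \<squnion> (x \<sqinter> m \<sqinter> x)"
proof -
  have S: "m \<in> S" "x \<in> S" "z \<in> S" using c precD by auto
  define r w t where "r = x \<sqinter> z" and "w = m \<squnion> z \<squnion> m" and "t = m \<squnion> (z \<sqinter> r \<sqinter> z) \<squnion> m"
  have rwS: "r \<in> S" "w \<in> S" using S by (simp_all add: r_def w_def)
  have r: "m \<preceq> r" "r \<preceq> z" "r \<preceq> x" using S c by (simp_all add: r_def prec_meet_iff)
  have s: "m \<preceq> z \<sqinter> r \<sqinter> z" "z \<sqinter> r \<sqinter> z \<preceq> x" "r \<preceq> z \<sqinter> r \<sqinter> z"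
    using S rwS r c by (simp_all add: prec_meet_iff meet_precI)
  have "t = w \<sqinter> (m \<squnion> r \<squnion> m) \<sqinter> w"
    using join_sandwich_distrib_chain[OF lin r(1,2)] by (simp add: t_def w_def)
  then have "t \<le>\<^sub>S w" using sandwich_leq S rwS by simp
  moreover have "x \<sqinter> w \<preceq> t"
  proof -
    have "w \<preceq> z" using S c by (simp add: w_def join_prec_iff)
    then have "x \<sqinter> w \<preceq> r" using S rwS by (simp add: r_def prec_meet_iff meet_precI)
    moreover have "r \<preceq> t" using s S rwS by (simp add: t_def prec_joinI)
    ultimately show ?thesis by (rule prec_trans)
  qed
  ultimately have "x \<sqinter> w \<sqinter> x = x \<sqinter> t \<sqinter> x" using sandwich_eq S by simp
  also have "\<dots> = (x \<sqinter> m \<sqinter> x) \<squnion> (x \<sqinter> (z \<sqinter> r \<sqinter> z) \<sqinter> x) \<squnion> (x \<sqinter> m \<sqinter> x)"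
    unfolding t_def by (rule sandwich_distrib_chain[OF lin s(1,2)])
  also have "x \<sqinter> (z \<sqinter> r \<sqinter> z) \<sqinter> x = x \<sqinter> z \<sqinter> x"
    using sandwich_eq[of x "z \<sqinter> r \<sqinter> z" z] sandwich_leq[of z r] S rwS s by (simp add: r_def)
  finally show ?thesis by (simp add: w_def)
qed

text \<open>
  The hypotheses put \<open>z\<close> in the class of \<open>(x \<sqinter> z) \<squnion> m\<close>. Choose \<open>s\<close> below \<open>z\<close> in the class of \<open>x \<sqinter> z\<close>
  and \<open>n\<close> below \<open>m\<close> in the class of \<open>x \<sqinter> m\<close>. Then \<open>t = n \<squnion> s \<squnion> n\<close> and \<open>m\<close> have \<open>n\<close> as common lower bound
  in the class of their meet, so they commute and \<open>m \<squnion> z \<squnion> m\<close> is simply their join. In particular it lies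
  above \<open>t\<close>, so that both have the same sandwich by \<open>x\<close>, while \<open>x, s, n\<close> is a chain.
\<close>

lemma sandwich_distrib_modular:
  assumes lin: "linearly_distributive S meet join" and us: "upper_symmetric S meet join"
    and xS: "x \<in> S" and c: "m \<preceq> z" "z \<preceq> (x \<sqinter> z) \<squnion> m"
  shows "x \<sqinter> (m \<squnion> z \<squnion> m) \<sqinter> x = (x \<sqinter> m \<sqinter> x) \<squnion> (x \<sqinter> z \<sqinter> x) \<squnion> (x \<sqinter> m \<sqinter> x)"
proof -
  have S: "m \<in> S" "x \<in> S" "z \<in> S" using c precD xS by auto
  define s n where "s = z \<sqinter> x \<sqinter> z" and "n = m \<sqinter> x \<sqinter> m"
  define t w where "t = n \<squnion> s \<squnion> n" and "w = m \<squnion> z \<squnion> m"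
  have S': "s \<in> S" "n \<in> S" using S by (simp_all add: s_def n_def)
  have S'': "t \<in> S" "w \<in> S" using S S' by (simp_all add: t_def w_def)
  have "n \<preceq> m" "n \<preceq> x" using S by (simp_all add: n_def meet_precI)
  then have ns: "n \<preceq> s" using S c prec_trans[of n m z] by (simp add: s_def prec_meet_iff)
  have sx: "s \<preceq> x" "s \<preceq> z" using S by (simp_all add: s_def meet_precI)
  have ts: "t \<preceq> s" "s \<preceq> t" using ns S' by (simp_all add: t_def join_prec_iff prec_joinI)
  have nm: "n \<le>\<^sub>S m" using sandwich_leq S by (simp add: n_def)
  have nt: "n \<le>\<^sub>S t" using join_sandwich_geq S' by (simp add: t_def)
  have "t \<preceq> x" using ts sx prec_trans by blast
  then have "m \<sqinter> t \<preceq> n" using S S'' by (simp add: n_def prec_meet_iff meet_precI)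
  then have "m \<sqinter> t = t \<sqinter> m" using nm nt meet_commute_of_common_lower_bound by blast
  then have mt: "m \<squnion> t = t \<squnion> m" using us S S'' by (simp add: upper_symmetric_def)
  \<comment> \<open>\<open>m \<squnion> s \<squnion> m \<le>\<^sub>S w\<close> by monotonicity, and the hypothesis on \<open>z\<close> puts both in one class.\<close>
  have "w = m \<squnion> s \<squnion> m"
  proof (rule leq_antisym_prec[symmetric])
    show "m \<squnion> s \<squnion> m \<le>\<^sub>S w"
      unfolding w_def s_def using S sandwich_leq by (intro join_sandwich_mono) auto
    have "x \<sqinter> z \<preceq> s" using S by (simp add: s_def prec_meet_iff)
    then have "(x \<sqinter> z) \<squnion> m \<preceq> m \<squnion> s \<squnion> m" using S S' by (simp add: join_prec_iff prec_joinI)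
    moreover have "w \<preceq> z" using S c by (simp add: w_def join_prec_iff)
    ultimately show "w \<preceq> m \<squnion> s \<squnion> m" using c prec_trans by blast
  qed
  also have "\<dots> = m \<squnion> t \<squnion> m"
  proof -
    have "m \<squnion> t \<squnion> m = (m \<squnion> n) \<squnion> s \<squnion> (n \<squnion> m)"
      using S S' by (simp add: t_def join_assoc)
    then show ?thesis using nm by (simp add: leq_iff_join)
  qed
  also have "\<dots> = t \<squnion> m" using S S'' mt by (simp add: join_assoc)
  finally have w: "w = t \<squnion> m" .
  have "t \<le>\<^sub>S w" unfolding w by (rule leq_join_of_commute[OF S''(1) S(1) mt[symmetric]])
  moreover have "x \<sqinter> w \<preceq> t"
  proof -
    have "w \<preceq> z" using S c by (simp add: w_def join_prec_iff)
    then have "x \<sqinter> w \<preceq> s" using S S'' by (simp add: s_def prec_meet_iff meet_precI)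
    then show ?thesis using ts prec_trans by blast
  qed
  ultimately have "x \<sqinter> w \<sqinter> x = x \<sqinter> t \<sqinter> x" using sandwich_eq S by simp
  also have "\<dots> = (x \<sqinter> n \<sqinter> x) \<squnion> (x \<sqinter> s \<sqinter> x) \<squnion> (x \<sqinter> n \<sqinter> x)"
    unfolding t_def by (rule sandwich_distrib_chain[OF lin ns sx(1)])
  also have "x \<sqinter> s \<sqinter> x = x \<sqinter> z \<sqinter> x"
    using sandwich_eq[of x s z] sandwich_leq[of z x] S by (simp add: s_def prec_meet_iff)
  also have "x \<sqinter> n \<sqinter> x = x \<sqinter> m \<sqinter> x"
    using sandwich_eq[of x n m] sandwich_leq[of m x] S by (simp add: n_def prec_meet_iff)
  finally show ?thesis by (simp add: w_def)
qed

text \<open>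
  The sandwich by \<open>x\<close> factors through the sandwich by \<open>g = x \<squnion> m \<squnion> x\<close>. As \<open>m\<close> is below \<open>g\<close>, the latter
  distributes, and the resulting elements lie below \<open>x \<squnion> m\<close>, where quasi-distributivity gives the
  hypothesis of \<open>sandwich_distrib_modular\<close>.
\<close>

lemma sandwich_distrib_comparable:
  assumes lin: "linearly_distributive S meet join" and us: "upper_symmetric S meet join"
    and quasi: prec_distributive and xS: "x \<in> S" and c: "m \<preceq> z"
  shows "x \<sqinter> (m \<squnion> z \<squnion> m) \<sqinter> x = (x \<sqinter> m \<sqinter> x) \<squnion> (x \<sqinter> z \<sqinter> x) \<squnion> (x \<sqinter> m \<sqinter> x)"
proof -
  have S: "m \<in> S" "x \<in> S" "z \<in> S" using c precD xS by auto
  define g where "g = x \<squnion> m \<squnion> x"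
  define m1 z1 where "m1 = g \<sqinter> m \<sqinter> g" and "z1 = g \<sqinter> z \<sqinter> g"
  have gS: "g \<in> S" using S by (simp add: g_def)
  have S': "m1 \<in> S" "z1 \<in> S" using S gS by (simp_all add: m1_def z1_def)
  have g: "x \<preceq> g" "m \<preceq> g" using S by (simp_all add: g_def prec_joinI)
  have mm1: "m \<preceq> m1" using g S gS by (simp add: m1_def prec_meet_iff)
  have "m1 \<preceq> z"
    using prec_trans[of m1 m z] c S gS by (simp add: m1_def meet_precI)
  then have m1z1: "m1 \<preceq> z1"
    using S gS S' by (simp add: z1_def prec_meet_iff, simp add: m1_def)
  have "z1 \<preceq> (x \<sqinter> z1) \<squnion> m1"
  proof -
    have "g \<preceq> x \<squnion> m" using S by (simp add: g_def join_prec_iff)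
    then have "z1 \<preceq> z \<sqinter> (x \<squnion> m)"
      using S gS by (simp add: z1_def prec_meet_iff meet_precI)
    also have "z \<sqinter> (x \<squnion> m) \<preceq> (z \<sqinter> x) \<squnion> (z \<sqinter> m)"
      using quasi S by (simp add: prec_distributive_def)
    also have "(z \<sqinter> x) \<squnion> (z \<sqinter> m) \<preceq> (x \<sqinter> z1) \<squnion> m1"
    proof -
      have "z \<sqinter> x \<preceq> x \<sqinter> z1"
        using S gS g by (simp add: z1_def prec_meet_iff meet_precI)
      moreover have "z \<sqinter> m \<preceq> m1" using mm1 S by (simp add: meet_precI)
      ultimately show ?thesis using S S' by (simp add: join_prec_iff prec_joinI)
    qed
    finally show ?thesis .
  qed
  with m1z1 have "x \<sqinter> (m1 \<squnion> z1 \<squnion> m1) \<sqinter> x = (x \<sqinter> m1 \<sqinter> x) \<squnion> (x \<sqinter> z1 \<sqinter> x) \<squnion> (x \<sqinter> m1 \<sqinter> x)"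
    using sandwich_distrib_modular lin us xS by blast
  moreover have "m1 \<squnion> z1 \<squnion> m1 = g \<sqinter> (m \<squnion> z \<squnion> m) \<sqinter> g"
    unfolding m1_def z1_def using sandwich_distrib_lower_bound[OF lin g(2) c] by simp
  ultimately show ?thesis
    using S g by (simp add: m1_def z1_def sandwich_sandwich)
qed

text \<open>
  With \<open>m = y \<sqinter> z \<sqinter> y\<close>, replacing \<open>z\<close> by \<open>z2 = m \<squnion> z \<squnion> m\<close> does not affect \<open>y \<squnion> z \<squnion> y\<close>, and makes the two
  arguments commute.
\<close>

lemma sandwich_distrib:
  assumes lin: "linearly_distributive S meet join" and us: "upper_symmetric S meet join"
    and quasi: prec_distributive and S: "x \<in> S" "y \<in> S" "z \<in> S"
  shows "x \<sqinter> (y \<squnion> z \<squnion> y) \<sqinter> x = (x \<sqinter> y \<sqinter> x) \<squnion> (x \<sqinter> z \<sqinter> x) \<squnion> (x \<sqinter> y \<sqinter> x)"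
proof -
  define m where "m = y \<sqinter> z \<sqinter> y"
  define z2 where "z2 = m \<squnion> z \<squnion> m"
  have S': "m \<in> S" "z2 \<in> S" using S by (simp_all add: m_def z2_def)
  have my: "m \<le>\<^sub>S y" using S sandwich_leq by (simp add: m_def)
  have mz: "m \<preceq> z" using S by (simp add: m_def meet_precI)
  have mz2: "m \<le>\<^sub>S z2" using S S' join_sandwich_geq by (simp add: z2_def)
  have "z2 \<preceq> z" using mz S S' by (simp add: z2_def join_prec_iff)
  then have "y \<sqinter> z2 \<preceq> m" using S S' by (simp add: m_def prec_meet_iff meet_precI)
  then have "y \<sqinter> z2 = z2 \<sqinter> y" using my mz2 meet_commute_of_common_lower_bound by blast
  then have comm: "y \<squnion> z2 = z2 \<squnion> y" using us S S' by (simp add: upper_symmetric_def)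
  define u where "u = y \<squnion> z2"
  have uS: "u \<in> S" using S S' by (simp add: u_def)
  have u: "y \<squnion> z \<squnion> y = u"
  proof -
    have "u = y \<squnion> z2 \<squnion> y" using S S' comm by (simp add: u_def join_assoc)
    also have "\<dots> = (y \<squnion> m) \<squnion> z \<squnion> (m \<squnion> y)" using S S' by (simp add: z2_def join_assoc)
    finally show ?thesis using my by (simp add: leq_iff_join)
  qed
  \<comment> \<open>A commuting join is an upper bound in the partial order, so sandwiching gives one inequality.\<close>
  have "y \<le>\<^sub>S u" "z2 \<le>\<^sub>S u"
    using leq_join_of_commute[of y z2] leq_join_of_commute[of z2 y] S S' comm by (simp_all add: u_def)
  then have le: "x \<sqinter> y \<sqinter> x \<le>\<^sub>S x \<sqinter> u \<sqinter> x" "x \<sqinter> z2 \<sqinter> x \<le>\<^sub>S x \<sqinter> u \<sqinter> x"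
    using sandwich_mono S by auto
  define v where "v = (x \<sqinter> y \<sqinter> x) \<squnion> (x \<sqinter> z2 \<sqinter> x) \<squnion> (x \<sqinter> y \<sqinter> x)"
  have vS: "v \<in> S" using S S' by (simp add: v_def)
  have "v = x \<sqinter> u \<sqinter> x"
  proof (rule leq_antisym_prec)
    show "v \<le>\<^sub>S x \<sqinter> u \<sqinter> x"
      using le vS S S' uS by (simp add: leq_iff_join v_def join_assoc, simp flip: join_assoc)
    \<comment> \<open>The reverse comparison of classes is quasi-distributivity.\<close>
    have "x \<sqinter> u \<sqinter> x \<preceq> x \<sqinter> (y \<squnion> z2)" using S uS by (simp add: u_def)
    also have "\<dots> \<preceq> (x \<sqinter> y) \<squnion> (x \<sqinter> z2)"
      using quasi S S' by (simp add: prec_distributive_def)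
    also have "\<dots> \<preceq> v"
    proof -
      have "x \<sqinter> y \<preceq> x \<sqinter> y \<sqinter> x" "x \<sqinter> z2 \<preceq> x \<sqinter> z2 \<sqinter> x"
        using S S' by (simp_all add: prec_meet_iff)
      then show ?thesis using S S' by (simp add: v_def join_prec_iff prec_joinI)
    qed
    finally show "x \<sqinter> u \<sqinter> x \<preceq> v" .
  qed
  also have "v = (x \<sqinter> y \<sqinter> x) \<squnion> (x \<sqinter> z \<sqinter> x) \<squnion> (x \<sqinter> y \<sqinter> x)"
  proof -
    have "x \<sqinter> z2 \<sqinter> x = (x \<sqinter> m \<sqinter> x) \<squnion> (x \<sqinter> z \<sqinter> x) \<squnion> (x \<sqinter> m \<sqinter> x)"
      unfolding z2_def using sandwich_distrib_comparable lin us quasi S mz by blast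
    then have "v = ((x \<sqinter> y \<sqinter> x) \<squnion> (x \<sqinter> m \<sqinter> x)) \<squnion> (x \<sqinter> z \<sqinter> x) \<squnion> ((x \<sqinter> m \<sqinter> x) \<squnion> (x \<sqinter> y \<sqinter> x))"
      using S S' by (simp add: v_def join_assoc)
    moreover have "x \<sqinter> m \<sqinter> x \<le>\<^sub>S x \<sqinter> y \<sqinter> x" using sandwich_mono my S by simp
    ultimately show ?thesis by (simp add: leq_iff_join)
  qed
  finally show ?thesis using u by simp
qed

section \<open>The characterisations\<close>

theorem meet_distributive_iff:
  assumes "upper_symmetric S meet join"
  shows "meet_distributive S meet join \<longleftrightarrow>
    quasi_distributive S meet join \<and> linearly_distributive S meet join"
  using assms quasi_distributive_iff prec_distributive_if_meet_distributive
    linearly_distributive_if_meet_distributive meet_distributive_if_sandwich sandwich_distrib by blast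

theorem join_distributive_iff:
  assumes "lower_symmetric S meet join"
  shows "join_distributive S meet join \<longleftrightarrow>
    quasi_distributive S meet join \<and> linearly_distributive S meet join"
proof -
  have "upper_symmetric S join meet"
    using assms by (simp add: upper_symmetric_def lower_symmetric_def)
  then show ?thesis
    using skew_lattice.meet_distributive_iff[OF dual] dual_meet_distributive
      dual_quasi_distributive dual_linearly_distributive by blast
qed

end

theorem theorem5p8:
  fixes S :: "'a set" and meet join :: "'a \<Rightarrow> 'a \<Rightarrow> 'a"
  assumes "skew_lattice S meet join"
  shows "(upper_symmetric S meet join \<longrightarrow>
            (meet_distributive S meet join \<longleftrightarrow>
              quasi_distributive S meet join \<and> linearly_distributive S meet join))
       \<and> (lower_symmetric S meet join \<longrightarrow>
            (join_distributive S meet join \<longleftrightarrow>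
              quasi_distributive S meet join \<and> linearly_distributive S meet join))
       \<and> (skew_symmetric S meet join \<longrightarrow>
            (skew_distributive S meet join \<longleftrightarrow>
              quasi_distributive S meet join \<and> linearly_distributive S meet join))"
proof -
  interpret skew_lattice S meet join by (rule assms)
  show ?thesis
    using meet_distributive_iff join_distributive_iff
    by (auto simp: skew_distributive_def skew_symmetric_def)
qed

end
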